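(* Let $n\ge1$, $p\in[0,1]$, and fix a probability space $(\Omega,\mathcal F,\mathbb P)$ on which bits $x=(x_1,\dots,x_n)\sim\pi_p$ are defined. For a random set $\mathcal I\subseteq[n]$ defined on this space, the following are equivalent: (i) there exists a filtration $\mathbb F$ such that $\mathcal I$ is a stopping set with respect to $\mathbb F$ and $x$ is an independent field with respect to $\mathbb F$; (ii) $\mathcal I$ is local.
   Context: $[n]=\{1,\dots,n\}$ and $\pi_p$ is the product measure on $\{0,1\}^n$ with each bit equal to $1$ with probability $p$. A filtration is a collection $\mathbb F=(\mathcal F_J)_{J\subseteq[n]}$ of sub-$\sigma$-algebras of $\mathcal F$, indexed by subsets of $[n]$, with $\mathcal F_{J_1}\subseteq\mathcal F_{J_2}$ whenever $J_1\subseteq J_2$. A random set $\mathcal I\subseteq[n]$ is a stopping set with respect to $\mathbb F$ if $\{\mathcal I=J\}\in\mathcal F_J$ for every fixed $J\subseteq[n]$. $x$ is an independent field with respect to $\mathbb F$ if for every fixed $J\subseteq[n]$, $\sigma(x_i:i\in J)\subseteq\mathcal F_J$ and $\sigma(x_i:i\notin J)$ is independent of $\mathcal F_J$. A random set $\mathcal I\subseteq[n]$ (not necessarily measurable with respect to $x$) is local if for every fixed $J\subseteq[n]$, $\sigma(\{\mathcal I=J\},(x_i:i\in J))$ is independent of $\sigma(x_i:i\notin J)$. *)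

theory Defs
  imports "HOL-Probability.Probability"
begin

text \<open>Bits are booleans, with \<^const>\<open>True\<close> standing for 1 and \<^const>\<open>False\<close> for 0.
  Points of \<open>{0,1}\<^sup>n\<close> are extensional functions on \<open>{1..n}\<close>.\<close>

definition pi_measure :: "nat \<Rightarrow> real \<Rightarrow> (nat \<Rightarrow> bool) measure" where
  "pi_measure n p = (\<Pi>\<^sub>M i\<in>{1..n}. measure_pmf (bernoulli_pmf p))"

definition random_bits :: "'a measure \<Rightarrow> nat \<Rightarrow> real \<Rightarrow> (nat \<Rightarrow> 'a \<Rightarrow> bool) \<Rightarrow> bool" where
  "random_bits M n p x \<longleftrightarrow>
     (\<lambda>\<omega>. \<lambda>i\<in>{1..n}. x i \<omega>) \<in> M \<rightarrow>\<^sub>M pi_measure n p \<and>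
     distr M (pi_measure n p) (\<lambda>\<omega>. \<lambda>i\<in>{1..n}. x i \<omega>) = pi_measure n p"

definition random_set :: "'a measure \<Rightarrow> nat \<Rightarrow> ('a \<Rightarrow> nat set) \<Rightarrow> bool" where
  "random_set M n I \<longleftrightarrow> I \<in> M \<rightarrow>\<^sub>M count_space (Pow {1..n})"

definition bit_events :: "'a measure \<Rightarrow> (nat \<Rightarrow> 'a \<Rightarrow> bool) \<Rightarrow> nat set \<Rightarrow> 'a set set" where
  "bit_events M x J = {x i -` A \<inter> space M | i A. i \<in> J}"

text \<open>For \<open>J = {}\<close> this is the trivial \<open>\<sigma>\<close>-algebra on \<open>space M\<close>.\<close>

definition sigma_bits :: "'a measure \<Rightarrow> (nat \<Rightarrow> 'a \<Rightarrow> bool) \<Rightarrow> nat set \<Rightarrow> 'a set set" where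
  "sigma_bits M x J = sigma_sets (space M) (bit_events M x J)"

text \<open>A \<open>\<sigma>\<close>-algebra \<open>\<F>\<^sub>J\<close> is represented by \<open>sets (F J)\<close>; the measure that \<open>F J\<close> carries
  is irrelevant, and so is \<open>F J\<close> for \<open>J\<close> not contained in \<open>{1..n}\<close>.\<close>

definition set_filtration :: "'a measure \<Rightarrow> nat \<Rightarrow> (nat set \<Rightarrow> 'a measure) \<Rightarrow> bool" where
  "set_filtration M n F \<longleftrightarrow>
     (\<forall>J\<subseteq>{1..n}. subalgebra M (F J)) \<and>
     (\<forall>J1 J2. J1 \<subseteq> J2 \<longrightarrow> J2 \<subseteq> {1..n} \<longrightarrow> sets (F J1) \<subseteq> sets (F J2))"

definition stopping_set ::
    "'a measure \<Rightarrow> nat \<Rightarrow> (nat set \<Rightarrow> 'a measure) \<Rightarrow> ('a \<Rightarrow> nat set) \<Rightarrow> bool" where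
  "stopping_set M n F I \<longleftrightarrow> (\<forall>J\<subseteq>{1..n}. {\<omega> \<in> space M. I \<omega> = J} \<in> sets (F J))"

definition independent_field ::
    "'a measure \<Rightarrow> nat \<Rightarrow> (nat set \<Rightarrow> 'a measure) \<Rightarrow> (nat \<Rightarrow> 'a \<Rightarrow> bool) \<Rightarrow> bool" where
  "independent_field M n F x \<longleftrightarrow>
     (\<forall>J\<subseteq>{1..n}. sigma_bits M x J \<subseteq> sets (F J) \<and>
        prob_space.indep_set M (sigma_bits M x ({1..n} - J)) (sets (F J)))"

definition local_set ::
    "'a measure \<Rightarrow> nat \<Rightarrow> (nat \<Rightarrow> 'a \<Rightarrow> bool) \<Rightarrow> ('a \<Rightarrow> nat set) \<Rightarrow> bool" where
  "local_set M n x I \<longleftrightarrow>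
     (\<forall>J\<subseteq>{1..n}.
        prob_space.indep_set M
          (sigma_sets (space M) (insert {\<omega> \<in> space M. I \<omega> = J} (bit_events M x J)))
          (sigma_bits M x ({1..n} - J)))"

end

theory Submission
  imports Defs
begin

text \<open>
  The forward direction is monotonicity of independence: for a stopping set, the event
  \<open>I = J\<close> and the bits in \<open>J\<close> all lie in \<open>\<F>\<^sub>J\<close>, and \<open>\<F>\<^sub>J\<close> is independent of the
  bits outside \<open>J\<close>.

  Conversely, take the smallest filtration that can work: \<open>\<F>\<^sub>J\<close> is generated by the
  bits in \<open>J\<close> together with the events \<open>I = K\<close> for all \<open>K \<subseteq> J\<close>. Independence of
  \<open>\<F>\<^sub>J\<close> from the bits outside \<open>J\<close> is not literally an instance of locality, which
  treats a single value \<open>K\<close> of \<open>I\<close> and only the bits in \<open>K\<close>. What saves the argument is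
  that the events \<open>I = K\<close> are disjoint for different \<open>K\<close>. Hence the sets \<open>A \<inter> C\<close>, where
  \<open>C\<close> is a cylinder over \<open>J\<close> and \<open>A\<close> is either trivial or a single event \<open>I = K\<close>, already
  form a \<open>\<pi>\<close>-system generating \<open>\<F>\<^sub>J\<close>, and it suffices to treat those.
  Split \<open>C = C\<^sub>1 \<inter> C\<^sub>2\<close> into a cylinder \<open>C\<^sub>1\<close> over \<open>K\<close> and a cylinder \<open>C\<^sub>2\<close> over \<open>J - K\<close>, and
  let \<open>B\<close> be an event of the bits outside \<open>J\<close>. Locality at \<open>K\<close> detaches
  \<open>{I = K} \<inter> C\<^sub>1\<close> from \<open>C\<^sub>2 \<inter> B\<close>, independence of the bits detaches \<open>C\<^sub>2\<close> from \<open>B\<close>, and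
  locality at \<open>K\<close> glues \<open>{I = K} \<inter> C\<^sub>1\<close> and \<open>C\<^sub>2\<close> together again.
\<close>

section \<open>Independence of pairs of set families\<close>

lemma (in prob_space) indep_set_mono:
  assumes "indep_set A B" "A' \<subseteq> A" "B' \<subseteq> B"
  shows "indep_set A' B'"
proof (rule indep_setI)
  show "A' \<subseteq> events" "B' \<subseteq> events"
    using assms indep_setD_ev1[OF assms(1)] indep_setD_ev2[OF assms(1)] by auto
  show "prob (a \<inter> b) = prob a * prob b" if "a \<in> A'" "b \<in> B'" for a b
    using that assms by (intro indep_setD[OF assms(1)]) auto
qed

lemma (in prob_space) indep_set_commute:
  assumes "indep_set A B"
  shows "indep_set B A"
proof (rule indep_setI)
  show "B \<subseteq> events" "A \<subseteq> events"
    using indep_setD_ev1[OF assms] indep_setD_ev2[OF assms] by auto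
  show "prob (b \<inter> a) = prob b * prob a" if "b \<in> B" "a \<in> A" for a b
    using indep_setD[OF assms that(2,1)] by (simp add: Int_commute mult.commute)
qed

section \<open>Cylinders and the sigma-algebras of the bits\<close>

lemma sigma_algebra_sigma_bits: "sigma_algebra (space M) (sigma_bits M x J)"
  unfolding sigma_bits_def bit_events_def by (rule sigma_algebra_sigma_sets) auto

lemma bit_events_mono:
  assumes "J \<subseteq> K"
  shows "bit_events M x J \<subseteq> bit_events M x K"
proof
  fix s assume "s \<in> bit_events M x J"
  then obtain i A where "i \<in> J" "s = x i -` A \<inter> space M"
    unfolding bit_events_def by blast
  then show "s \<in> bit_events M x K"
    using assms unfolding bit_events_def by blast
qed

lemma sigma_bits_mono: "J \<subseteq> K \<Longrightarrow> sigma_bits M x J \<subseteq> sigma_bits M x K"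
  unfolding sigma_bits_def by (intro sigma_sets_mono' bit_events_mono)

definition bit_cylinder ::
    "'a measure \<Rightarrow> (nat \<Rightarrow> 'a \<Rightarrow> bool) \<Rightarrow> nat set \<Rightarrow> (nat \<Rightarrow> bool set) \<Rightarrow> 'a set" where
  "bit_cylinder M x J a = {\<omega> \<in> space M. \<forall>i\<in>J. x i \<omega> \<in> a i}"

lemma bit_cylinder_Int:
  "bit_cylinder M x J a \<inter> bit_cylinder M x J b = bit_cylinder M x J (\<lambda>i. a i \<inter> b i)"
  by (auto simp: bit_cylinder_def)

lemma bit_cylinder_in_sigma_bits:
  assumes "finite J"
  shows "bit_cylinder M x J a \<in> sigma_bits M x J"
proof -
  interpret sigma_algebra "space M" "sigma_bits M x J"
    by (rule sigma_algebra_sigma_bits)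
  have bit: "{\<omega> \<in> space M. x i \<omega> \<in> a i} \<in> sigma_bits M x J" if "i \<in> J" for i
  proof -
    have "{\<omega> \<in> space M. x i \<omega> \<in> a i} = x i -` a i \<inter> space M" by auto
    then show ?thesis
      using that unfolding sigma_bits_def bit_events_def
      by (intro sigma_sets.Basic) blast
  qed
  show ?thesis
    unfolding bit_cylinder_def by (rule sets_Collect_finite_All[OF bit assms])
qed

text \<open>The coordinates of a \<open>\<pi>\<^sub>p\<close>-distributed vector are independent, and independence survives
  grouping them into two disjoint blocks.\<close>

lemma (in prob_space) random_bits_indep_set:
  assumes "n \<ge> 1" and bits: "random_bits M n p x" and J: "J \<subseteq> {1..n}"
  shows "indep_set (sigma_bits M x J) (sigma_bits M x ({1..n} - J))"
proof -
  let ?b = "measure_pmf (bernoulli_pmf p)"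
  let ?X = "\<lambda>\<omega>. \<lambda>i\<in>{1..n}. x i \<omega>"
  have meas: "?X \<in> M \<rightarrow>\<^sub>M pi_measure n p"
    and law: "distr M (pi_measure n p) ?X = pi_measure n p"
    using bits by (auto simp: random_bits_def)
  have proj: "(\<lambda>f. f i) \<in> pi_measure n p \<rightarrow>\<^sub>M ?b" if "i \<in> {1..n}" for i
    unfolding pi_measure_def by (rule measurable_component_singleton[OF that])
  have coord: "x i \<in> M \<rightarrow>\<^sub>M ?b" if "i \<in> {1..n}" for i
    using measurable_compose[OF meas proj[OF that]] that by simp
  have marginal: "distr M ?b (x i) = ?b" if "i \<in> {1..n}" for i
  proof -
    have "distr M ?b (x i) = distr (distr M (pi_measure n p) ?X) ?b (\<lambda>f. f i)"
      using that by (subst distr_distr[OF proj[OF that] meas]) (simp add: comp_def)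
    also have "\<dots> = ?b"
      unfolding law unfolding pi_measure_def
      by (rule distr_PiM_component[OF _ that]) (rule prob_space_measure_pmf)
    finally show ?thesis .
  qed
  have "indep_vars (\<lambda>_. ?b) x {1..n}"
  proof (subst indep_vars_iff_distr_eq_PiM')
    show "distr M (PiM {1..n} (\<lambda>_. ?b)) ?X = (\<Pi>\<^sub>M i\<in>{1..n}. distr M ?b (x i))"
      unfolding law[unfolded pi_measure_def] by (rule PiM_cong) (simp_all only: marginal)
  qed (use \<open>n \<ge> 1\<close> coord in auto)
  then have indep: "indep_sets (\<lambda>i. {x i -` A \<inter> space M | A. True}) {1..n}"
    by (simp add: indep_vars_def2)
  let ?I = "case_bool J ({1..n} - J)"
  have "indep_sets (\<lambda>j. sigma_sets (space M) (\<Union>i\<in>?I j. {x i -` A \<inter> space M | A. True})) UNIV"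
  proof (rule indep_sets_collect_sigma)
    have "(\<Union>j. ?I j) = {1..n}"
      using J by (auto simp: UNIV_bool)
    then show "indep_sets (\<lambda>i. {x i -` A \<inter> space M | A. True}) (\<Union>j. ?I j)"
      using indep by simp
    show "Int_stable {x i -` A \<inter> space M | A. True}" for i
    proof (rule Int_stableI)
      fix a b assume "a \<in> {x i -` A \<inter> space M | A. True}" "b \<in> {x i -` A \<inter> space M | A. True}"
      then obtain A B where "a = x i -` A \<inter> space M" "b = x i -` B \<inter> space M" by blast
      then have "a \<inter> b = x i -` (A \<inter> B) \<inter> space M" by auto
      then show "a \<inter> b \<in> {x i -` A \<inter> space M | A. True}" by blast
    qed
    show "disjoint_family_on ?I UNIV"
      by (auto simp: disjoint_family_on_def split: bool.split)
  qed
  moreover have "bit_events M x K = (\<Union>i\<in>K. {x i -` A \<inter> space M | A. True})" for K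
    by (auto simp: bit_events_def)
  then have "(\<lambda>j. sigma_sets (space M) (\<Union>i\<in>?I j. {x i -` A \<inter> space M | A. True}))
      = case_bool (sigma_bits M x J) (sigma_bits M x ({1..n} - J))"
    by (auto simp: sigma_bits_def fun_eq_iff split: bool.split)
  ultimately show ?thesis
    by (simp add: indep_set_def)
qed

section \<open>The natural filtration of a random set\<close>

definition natural_generator ::
    "'a measure \<Rightarrow> (nat \<Rightarrow> 'a \<Rightarrow> bool) \<Rightarrow> ('a \<Rightarrow> nat set) \<Rightarrow> nat set \<Rightarrow> 'a set set" where
  "natural_generator M x I J = {{\<omega> \<in> space M. I \<omega> = K} | K. K \<subseteq> J} \<union> bit_events M x J"

definition natural_filtration ::
    "'a measure \<Rightarrow> (nat \<Rightarrow> 'a \<Rightarrow> bool) \<Rightarrow> ('a \<Rightarrow> nat set) \<Rightarrow> nat set \<Rightarrow> 'a measure" where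
  "natural_filtration M x I J = sigma (space M) (natural_generator M x I J)"

lemma natural_generator_mono:
  "J \<subseteq> K \<Longrightarrow> natural_generator M x I J \<subseteq> natural_generator M x I K"
  unfolding natural_generator_def by (intro Un_mono bit_events_mono) auto

lemma sets_natural_filtration:
  "sets (natural_filtration M x I J) = sigma_sets (space M) (natural_generator M x I J)"
  unfolding natural_filtration_def
  by (rule sets_measure_of) (auto simp: natural_generator_def bit_events_def)

text \<open>The empty set is a possible first factor so that intersecting the events of two different
  values of \<open>I\<close> stays inside the family. This is what makes it a \<open>\<pi>\<close>-system.\<close>

definition value_cylinders ::
    "'a measure \<Rightarrow> (nat \<Rightarrow> 'a \<Rightarrow> bool) \<Rightarrow> ('a \<Rightarrow> nat set) \<Rightarrow> nat set \<Rightarrow> 'a set set" where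
  "value_cylinders M x I J =
     {A \<inter> bit_cylinder M x J a | A a.
        A = {} \<or> A = space M \<or> (\<exists>K\<subseteq>J. A = {\<omega> \<in> space M. I \<omega> = K})}"

lemma Int_stable_value_cylinders: "Int_stable (value_cylinders M x I J)"
proof (rule Int_stableI)
  let ?value = "\<lambda>A. A = {} \<or> A = space M \<or> (\<exists>K\<subseteq>J. A = {\<omega> \<in> space M. I \<omega> = K})"
  fix s t assume "s \<in> value_cylinders M x I J" "t \<in> value_cylinders M x I J"
  then obtain A a B b where
    s: "s = A \<inter> bit_cylinder M x J a" and A: "?value A" and
    t: "t = B \<inter> bit_cylinder M x J b" and B: "?value B"
    unfolding value_cylinders_def by blast
  have "?value (A \<inter> B)"
  proof (cases "A = {} \<or> A = space M \<or> B = {} \<or> B = space M")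
    case True
    moreover have "A \<subseteq> space M" "B \<subseteq> space M" using A B by auto
    then have "A \<inter> space M = A" "space M \<inter> B = B" by auto
    ultimately show ?thesis using A B by auto
  next
    case False
    then obtain K L where K: "K \<subseteq> J" "A = {\<omega> \<in> space M. I \<omega> = K}"
      and L: "B = {\<omega> \<in> space M. I \<omega> = L}" using A B by blast
    show ?thesis
    proof (cases "K = L")
      case True
      then have "A \<inter> B = A" using K L by simp
      then show ?thesis using A by simp
    next
      case False
      then have "A \<inter> B = {}" using K L by auto
      then show ?thesis by simp
    qed
  qed
  moreover have "s \<inter> t = (A \<inter> B) \<inter> bit_cylinder M x J (\<lambda>i. a i \<inter> b i)"
    unfolding s t bit_cylinder_Int[symmetric] by blast
  ultimately show "s \<inter> t \<in> value_cylinders M x I J"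
    unfolding value_cylinders_def by blast
qed

lemma natural_generator_subset_value_cylinders:
  "natural_generator M x I J \<subseteq> value_cylinders M x I J"
proof
  fix s assume "s \<in> natural_generator M x I J"
  then consider (val) K where "K \<subseteq> J" "s = {\<omega> \<in> space M. I \<omega> = K}"
    | (bit) i A where "i \<in> J" "s = x i -` A \<inter> space M"
    unfolding natural_generator_def bit_events_def by blast
  then show "s \<in> value_cylinders M x I J"
  proof cases
    case val
    have "s = s \<inter> bit_cylinder M x J (\<lambda>_. UNIV)"
      using val by (auto simp: bit_cylinder_def)
    then show ?thesis
      using val unfolding value_cylinders_def by blast
  next
    case bit
    have "s = space M \<inter> bit_cylinder M x J ((\<lambda>_. UNIV)(i := A))"
      using bit by (auto simp: bit_cylinder_def)
    then show ?thesis
      unfolding value_cylinders_def by blast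
  qed
qed

text \<open>The core computation. The bits outside \<open>K\<close> split into those in \<open>J - K\<close> and those outside
  \<open>J\<close>, and locality at \<open>K\<close> is applied both with the second group present and without it.\<close>

lemma (in prob_space) local_set_value_cylinder:
  assumes loc: "local_set M n x I"
    and bits: "indep_set (sigma_bits M x J) (sigma_bits M x ({1..n} - J))"
    and K: "K \<subseteq> J" and J: "J \<subseteq> {1..n}"
    and B: "B \<in> sigma_bits M x ({1..n} - J)"
  defines "V \<equiv> {\<omega> \<in> space M. I \<omega> = K}"
  shows "prob ((V \<inter> bit_cylinder M x J a) \<inter> B) = prob (V \<inter> bit_cylinder M x J a) * prob B"
proof -
  let ?S = "sigma_sets (space M) (insert V (bit_events M x K))"
  let ?C1 = "bit_cylinder M x K a" and ?C2 = "bit_cylinder M x (J - K) a"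
  have fin: "finite J" "finite K"
    using J K finite_subset[of _ "{1..n}"] by auto
  have locK: "indep_set ?S (sigma_bits M x ({1..n} - K))"
    using loc K J unfolding local_set_def V_def by blast
  have VC1: "V \<inter> ?C1 \<in> ?S"
  proof -
    interpret S: sigma_algebra "space M" ?S
      by (rule sigma_algebra_sigma_sets) (auto simp: V_def bit_events_def)
    have "sigma_bits M x K \<subseteq> ?S"
      unfolding sigma_bits_def by (rule sigma_sets_mono') blast
    then have "?C1 \<in> ?S"
      using bit_cylinder_in_sigma_bits[OF fin(2)] by blast
    moreover have "V \<in> ?S" by (rule sigma_sets.Basic) simp
    ultimately show ?thesis by (rule S.Int[rotated])
  qed
  have C2: "?C2 \<in> sigma_bits M x (J - K)"
    by (rule bit_cylinder_in_sigma_bits) (simp add: fin)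
  have C2_out: "?C2 \<in> sigma_bits M x ({1..n} - K)"
    using C2 sigma_bits_mono[of "J - K" "{1..n} - K" M x] J by blast
  have B_out: "B \<in> sigma_bits M x ({1..n} - K)"
    using B sigma_bits_mono[of "{1..n} - J" "{1..n} - K" M x] K by blast
  interpret O: sigma_algebra "space M" "sigma_bits M x ({1..n} - K)"
    by (rule sigma_algebra_sigma_bits)
  have split: "V \<inter> bit_cylinder M x J a = (V \<inter> ?C1) \<inter> ?C2"
    using K by (auto simp: bit_cylinder_def)
  have "prob ((V \<inter> bit_cylinder M x J a) \<inter> B) = prob ((V \<inter> ?C1) \<inter> (?C2 \<inter> B))"
    by (simp add: split Int_assoc)
  also have "\<dots> = prob (V \<inter> ?C1) * prob (?C2 \<inter> B)"
    by (rule indep_setD[OF locK VC1]) (rule O.Int[OF C2_out B_out])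
  also have "prob (?C2 \<inter> B) = prob ?C2 * prob B"
    using C2 sigma_bits_mono[of "J - K" J M x] by (intro indep_setD[OF bits _ B]) blast
  also have "prob (V \<inter> ?C1) * (prob ?C2 * prob B) = (prob (V \<inter> ?C1) * prob ?C2) * prob B"
    by simp
  also have "prob (V \<inter> ?C1) * prob ?C2 = prob (V \<inter> bit_cylinder M x J a)"
    using indep_setD[OF locK VC1 C2_out] by (simp add: split)
  finally show ?thesis .
qed

lemma (in prob_space) natural_filtration_indep:
  assumes loc: "local_set M n x I"
    and bits: "indep_set (sigma_bits M x J) (sigma_bits M x ({1..n} - J))"
    and I: "random_set M n I" and J: "J \<subseteq> {1..n}"
  shows "indep_set (sets (natural_filtration M x I J)) (sigma_bits M x ({1..n} - J))"
proof -
  let ?B = "sigma_bits M x ({1..n} - J)"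
  have cyl: "bit_cylinder M x J a \<in> sigma_bits M x J" for a
    using J finite_subset by (intro bit_cylinder_in_sigma_bits) auto
  have ev: "bit_cylinder M x J a \<in> events" for a
    using cyl indep_setD_ev1[OF bits] by blast
  have val: "{\<omega> \<in> space M. I \<omega> = K} \<in> events" if "K \<subseteq> J" for K
  proof -
    have "I -` {K} \<inter> space M \<in> events"
      using I that J unfolding random_set_def by (intro measurable_sets) auto
    moreover have "I -` {K} \<inter> space M = {\<omega> \<in> space M. I \<omega> = K}" by auto
    ultimately show ?thesis by simp
  qed
  have "indep_set (value_cylinders M x I J) ?B"
  proof (rule indep_setI)
    show "value_cylinders M x I J \<subseteq> events"
      using ev val by (auto simp: value_cylinders_def)
    show "?B \<subseteq> events" by (rule indep_setD_ev2[OF bits])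
    fix s B assume "s \<in> value_cylinders M x I J" and B: "B \<in> ?B"
    then consider "s = {}" | a where "s = space M \<inter> bit_cylinder M x J a"
      | K a where "K \<subseteq> J" "s = {\<omega> \<in> space M. I \<omega> = K} \<inter> bit_cylinder M x J a"
      unfolding value_cylinders_def by blast
    then show "prob (s \<inter> B) = prob s * prob B"
    proof cases
      case (2 a)
      then have "s = bit_cylinder M x J a" by (auto simp: bit_cylinder_def)
      then show ?thesis using indep_setD[OF bits cyl B] by simp
    next
      case (3 K a)
      then show ?thesis using local_set_value_cylinder[OF loc bits _ J B] by simp
    qed simp
  qed
  moreover have "Int_stable ?B"
  proof -
    interpret O: sigma_algebra "space M" ?B by (rule sigma_algebra_sigma_bits)
    show ?thesis by (rule Int_stableI) (rule O.Int)
  qed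
  ultimately have "indep_set (sigma_sets (space M) (value_cylinders M x I J)) (sigma_sets (space M) ?B)"
    by (intro indep_set_sigma_sets Int_stable_value_cylinders)
  then show ?thesis
    by (rule indep_set_mono)
      (auto simp: sets_natural_filtration
        dest: sigma_sets_mono'[OF natural_generator_subset_value_cylinders, THEN subsetD])
qed

section \<open>Stopping sets with an independent field are exactly the local sets\<close>

theorem proposition2p8:
  fixes M :: "'a measure" and n :: nat and p :: real
    and x :: "nat \<Rightarrow> 'a \<Rightarrow> bool" and I :: "'a \<Rightarrow> nat set"
  assumes "prob_space M"
    and "n \<ge> 1"
    and "0 \<le> p" and "p \<le> 1"
    and "random_bits M n p x"
    and "random_set M n I"
  shows "(\<exists>F. set_filtration M n F \<and> stopping_set M n F I \<and> independent_field M n F x)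
         \<longleftrightarrow> local_set M n x I"
proof
  interpret prob_space M by fact
  assume "\<exists>F. set_filtration M n F \<and> stopping_set M n F I \<and> independent_field M n F x"
  then obtain F where filt: "set_filtration M n F" and stop: "stopping_set M n F I"
    and field: "independent_field M n F x" by blast
  show "local_set M n x I"
    unfolding local_set_def
  proof (intro allI impI)
    fix J assume J: "J \<subseteq> {1..n}"
    have "space (F J) = space M"
      using filt J by (auto simp: set_filtration_def subalgebra_def)
    moreover have "insert {\<omega> \<in> space M. I \<omega> = J} (bit_events M x J) \<subseteq> sets (F J)"
      using stop field J
      by (auto simp: stopping_set_def independent_field_def sigma_bits_def)
    ultimately have "sigma_sets (space M) (insert {\<omega> \<in> space M. I \<omega> = J} (bit_events M x J))
        \<subseteq> sets (F J)"
      using sets.sigma_sets_subset[of _ "F J"] by simp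
    moreover have "indep_set (sets (F J)) (sigma_bits M x ({1..n} - J))"
      using field J by (auto simp: independent_field_def intro: indep_set_commute)
    ultimately show "indep_set
        (sigma_sets (space M) (insert {\<omega> \<in> space M. I \<omega> = J} (bit_events M x J)))
        (sigma_bits M x ({1..n} - J))"
      by (blast intro: indep_set_mono)
  qed
next
  interpret prob_space M by fact
  assume loc: "local_set M n x I"
  let ?F = "natural_filtration M x I"
  have indep: "indep_set (sets (?F J)) (sigma_bits M x ({1..n} - J))" if "J \<subseteq> {1..n}" for J
    using natural_filtration_indep[OF loc random_bits_indep_set] assms that by blast
  have "set_filtration M n ?F"
    unfolding set_filtration_def subalgebra_def
  proof (intro conjI allI impI)
    show "space (?F J) = space M" for J
      by (simp add: natural_filtration_def space_measure_of_conv)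
    show "sets (?F J) \<subseteq> events" if "J \<subseteq> {1..n}" for J
      by (rule indep_setD_ev1[OF indep[OF that]])
    show "sets (?F J1) \<subseteq> sets (?F J2)" if "J1 \<subseteq> J2" for J1 J2
      unfolding sets_natural_filtration
      by (intro sigma_sets_mono' natural_generator_mono that)
  qed
  moreover have "stopping_set M n ?F I"
    unfolding stopping_set_def sets_natural_filtration
    by (intro allI impI sigma_sets.Basic) (auto simp: natural_generator_def)
  moreover have "independent_field M n ?F x"
    unfolding independent_field_def
  proof (intro allI impI conjI)
    fix J assume J: "J \<subseteq> {1..n}"
    show "sigma_bits M x J \<subseteq> sets (?F J)"
      unfolding sets_natural_filtration sigma_bits_def natural_generator_def
      by (rule sigma_sets_mono') blast
    show "indep_set (sigma_bits M x ({1..n} - J)) (sets (?F J))"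
      by (rule indep_set_commute[OF indep[OF J]])
  qed
  ultimately show "\<exists>F. set_filtration M n F \<and> stopping_set M n F I \<and> independent_field M n F x"
    by blast
qed

end
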